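(* Let $\mathcal{H}$ be a real Hilbert space and let $A:\mathcal{H}\to2^{\mathcal{H}}$ be maximally monotone with $\operatorname{zer}A\neq\varnothing$. Let $x_0\in\mathcal{H}$, and for every $k\in\mathbb{N}$ let $\lambda_k\in(0,2]$, $c_k\in(0,\infty)$, $\eta_k\in[0,\infty)$ and $e_k\in\mathcal{H}$. Define $$(\forall k\in\mathbb{N})\quad x_{k+1}=(1-\lambda_k)x_k+\lambda_kJ_{c_kA}x_k+\eta_ke_k .$$ Suppose that $\sum_{k\in\mathbb{N}}\eta_k\|e_k\|<\infty$ and that there exists $c\in(0,\infty)$ such that $\sum_{k\in\mathbb{N}}\left|\frac{c_k}{c}-1\right|<\infty$ (e.g., $c_k=c$ for all $k$). Then the following hold. (i) Define $$(\forall i\in\mathbb{N})(\forall k\in\mathbb{N})\quad \xi_{k+1}(i)=\left((1-\lambda_{k+i})\operatorname{Id}+\lambda_{k+i}J_{cA}\right)\xi_k(i)\quad\text{and}\quad \xi_0(i)=x_i .$$ Suppose that for every $i\in\mathbb{N}$ the sequence $(\xi_k(i))_{k\in\mathbb{N}}$ converges weakly to a point $\xi(i)\in\mathcal{H}$. Then: (a) there exists a point $\bar\xi\in\mathcal{H}$ such that $(\xi(i))_{i\in\mathbb{N}}$ converges strongly to $\bar\xi$; (b) $(x_k)_{k\in\mathbb{N}}$ converges weakly to $\bar\xi=\lim_{i\to\infty}\xi(i)$; (c) if for every $i\in\mathbb{N}$ the sequence $(\xi_k(i))_{k\in\mathbb{N}}$ converges strongly to a point $\xi(i)\in\mathcal{H}$,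 then $(x_k)_{k\in\mathbb{N}}$ converges strongly to $\bar\xi=\lim_{i\to\infty}\xi(i)$. (ii) Suppose that $\sum_{k\in\mathbb{N}}\lambda_k(2-\lambda_k)=\infty$. Then $(x_k)_{k\in\mathbb{N}}$ converges weakly to a point in $\operatorname{zer}A$.
   Context: $\mathbb{N}=\{0,1,2,\ldots\}$. A set-valued operator $A:\mathcal{H}\to2^{\mathcal{H}}$ is monotone if $\langle x-y,u-v\rangle\ge0$ whenever $u\in Ax$, $v\in Ay$, and maximally monotone if no monotone operator has a graph properly containing that of $A$. $\operatorname{zer}A=\{x\in\mathcal{H}:0\in Ax\}$. For $c>0$, $J_{cA}=(\operatorname{Id}+cA)^{-1}$ is the resolvent, which for maximally monotone $A$ is single-valued and defined on all of $\mathcal{H}$. Strong convergence means convergence in norm. *)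

theory Defs
  imports "HOL-Analysis.Analysis"
begin

type_synonym 'a set_op = "'a \<Rightarrow> 'a set"

definition gra :: "'a set_op \<Rightarrow> ('a \<times> 'a) set" where
  "gra A = {(x, u). u \<in> A x}"

definition monotone_op :: "'a::real_inner set_op \<Rightarrow> bool" where
  "monotone_op A \<longleftrightarrow> (\<forall>x y u v. u \<in> A x \<longrightarrow> v \<in> A y \<longrightarrow> (x - y) \<bullet> (u - v) \<ge> 0)"

definition maximally_monotone_op :: "'a::real_inner set_op \<Rightarrow> bool" where
  "maximally_monotone_op A \<longleftrightarrow>
     monotone_op A \<and> \<not> (\<exists>B. monotone_op B \<and> gra A \<subset> gra B)"

definition zer :: "'a::zero set_op \<Rightarrow> 'a set" where
  "zer A = {x. 0 \<in> A x}"

definition id_op :: "'a set_op" where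
  "id_op x = {x}"

definition add_op :: "'a::plus set_op \<Rightarrow> 'a set_op \<Rightarrow> 'a set_op" where
  "add_op A B x = {u + v | u v. u \<in> A x \<and> v \<in> B x}"

definition scale_op :: "real \<Rightarrow> 'a::real_vector set_op \<Rightarrow> 'a set_op" where
  "scale_op c A x = (\<lambda>u. c *\<^sub>R u) ` A x"

definition inv_op :: "'a set_op \<Rightarrow> 'a set_op" where
  "inv_op A u = {x. u \<in> A x}"

definition resolvent_op :: "'a::real_vector set_op \<Rightarrow> 'a set_op" where
  "resolvent_op A = inv_op (add_op id_op A)"

text \<open>The point-valued resolvent. It is meaningful only where the set-valued resolvent is a
  singleton, which is the case everywhere if \<open>A\<close> is a positive multiple of a maximally monotone
  operator on a Hilbert space (Minty's theorem); elsewhere its value is unspecified.\<close>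

definition resolvent :: "'a::real_vector set_op \<Rightarrow> 'a \<Rightarrow> 'a" where
  "resolvent A x = the_elem (resolvent_op A x)"

text \<open>Weak convergence in a Hilbert space: the weak topology is the one generated by the
  functionals \<open>y \<mapsto> y \<bullet> u\<close>.\<close>

definition weakly_converges :: "(nat \<Rightarrow> 'a::real_inner) \<Rightarrow> 'a \<Rightarrow> bool" where
  "weakly_converges x l \<longleftrightarrow> (\<forall>u. (\<lambda>k. x k \<bullet> u) \<longlonglongrightarrow> l \<bullet> u)"

end

theory Submission
  imports Defs
begin

text \<open>
  Write \<open>J\<close> for the resolvent of \<open>c A\<close> and \<open>T\<^sub>k\<close> for its relaxation with parameter \<open>\<lambda>\<^sub>k\<close>. The sequence
  \<open>x\<close> is an orbit of the exact iteration \<open>u \<mapsto> T\<^sub>k u\<close> up to an error in each step. That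
  error consists of \<open>\<eta>\<^sub>k e\<^sub>k\<close> and of the effect of using \<open>c\<^sub>k\<close> instead of \<open>c\<close>; the latter is at most
  \<open>2 |c\<^sub>k / c - 1|\<close> times the distance of \<open>x\<^sub>k\<close> from a zero, which stays bounded. So the errors are
  summable (\<open>proximal_iteration_errors_summable\<close>).

  For summable errors the conclusions on \<open>\<xi>\<close> hold for any nonexpansive maps
  \<open>T\<^sub>k\<close> (\<open>perturbed_nonexpansive_iteration\<close>): an exact orbit started at \<open>x\<^sub>i\<close> stays within the
  \<open>i\<close>-th tail of the error series from \<open>x\<close>, and the weak limits of two such orbits are separated by
  no more than the errors between their starting times. The last part of the theorem
  follows from this, since under divergence of \<open>\<Sum> \<lambda>\<^sub>k (2 - \<lambda>\<^sub>k)\<close> every exact orbit converges weakly to a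
  zero (\<open>exact_relaxed_iteration_weakly_converges\<close>) and the set of zeros is closed.

  Two classical facts about Hilbert spaces enter: Minty's theorem, which makes resolvents total, and
  weak compactness, which produces candidates for weak limits. Both are reached through a single
  elementary principle, the existence of minimisers of strongly convex functions
  (\<open>strongly_convex_minimiser\<close>). Applied to the Fitzpatrick function of the operator, it yields
  Minty's theorem; applied to projections, it shows that the closed convex hulls of the tails of a
  bounded sequence have a common point. Such points are as good as weak cluster points here, since
  both the half-space conditions that characterise zeros and the limits of \<open>\<xi>\<^sub>k \<bullet> u\<close>
  pass from the sequence to them.
\<close>

section \<open>Hilbert space preliminaries\<close>

lemma Cauchy_if_norm_diff_le:
  fixes f :: "nat \<Rightarrow> 'a::real_normed_vector"
  assumes "\<And>m n. n \<le> m \<Longrightarrow> norm (f m - f n) \<le> r n" and "r \<longlonglongrightarrow> 0"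
  shows "Cauchy f"
proof (rule CauchyI)
  fix e :: real assume "e > 0"
  then have "\<forall>\<^sub>F n in sequentially. r n < e / 2"
    using assms(2) by (intro order_tendstoD(2)[where y = 0]) auto
  then obtain N where N: "r N < e / 2" by (auto simp: eventually_sequentially)
  have "norm (f m - f n) < e" if "m \<ge> N" "n \<ge> N" for m n
    using norm_triangle_ineq4[of "f m - f N" "f n - f N"] assms(1)[of N m] assms(1)[of N n] that N
    by simp
  then show "\<exists>M. \<forall>m\<ge>M. \<forall>n\<ge>M. norm (f m - f n) < e" by blast
qed

text \<open>The single minimisation principle behind everything that follows. Read \<open>S\<close> as the epigraph of
  a closed convex function \<open>F\<close> that may take the value \<open>+\<infinity>\<close>: the function
  \<open>F + \<parallel>\<cdot>\<parallel>\<^sup>2 / 2\<close> is strongly convex, so by the parallelogram law its minimising sequences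
  are Cauchy, and the conclusion is the first-order optimality condition at the minimiser.\<close>

lemma strongly_convex_minimiser:
  fixes S :: "('a::{real_inner, complete_space} \<times> real) set"
  assumes "convex S" "closed S" "S \<noteq> {}"
    and lower: "\<And>w t. (w, t) \<in> S \<Longrightarrow> L \<le> t + (norm w)\<^sup>2 / 2"
  obtains w t where "(w, t) \<in> S" "\<And>w' t'. (w', t') \<in> S \<Longrightarrow> t \<le> t' + w \<bullet> (w' - w)"
proof -
  define \<phi> :: "'a \<times> real \<Rightarrow> real" where "\<phi> s = snd s + (norm (fst s))\<^sup>2 / 2" for s
  define m where "m = (INF s\<in>S. \<phi> s)"
  have bdd: "bdd_below (\<phi> ` S)"
    using lower by (auto simp: \<phi>_def intro!: bdd_belowI2[where m = L])
  have m_le: "m \<le> \<phi> s" if "s \<in> S" for s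
    unfolding m_def using bdd that by (rule cINF_lower)
  have "\<exists>s\<in>S. \<phi> s < m + 1 / real (Suc n)" for n
    using cINF_less_iff[OF \<open>S \<noteq> {}\<close> bdd, of "m + 1 / real (Suc n)"] by (simp add: m_def)
  then obtain s where sS: "\<And>n. s n \<in> S" and s_less: "\<And>n. \<phi> (s n) < m + 1 / real (Suc n)"
    by metis
  have gap: "(norm (fst a - fst b))\<^sup>2 \<le> 4 * (\<phi> a - m) + 4 * (\<phi> b - m)"
    if "a \<in> S" "b \<in> S" for a b
  proof -
    have "(1/2) *\<^sub>R a + (1/2) *\<^sub>R b \<in> S"
      using \<open>convex S\<close> that by (intro convexD) auto
    from m_le[OF this] show ?thesis
      by (simp add: \<phi>_def power2_norm_eq_inner inner_simps inner_commute field_simps)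
  qed
  have gap_s: "norm (fst (s k) - fst (s n)) \<le> sqrt (8 / real (Suc n))" if "n \<le> k" for k n
  proof (rule real_le_rsqrt)
    have "1 / real (Suc k) \<le> 1 / real (Suc n)" using that by (simp add: field_simps)
    then show "(norm (fst (s k) - fst (s n)))\<^sup>2 \<le> 8 / real (Suc n)"
      using gap[OF sS[of k] sS[of n]] s_less[of k] s_less[of n] by simp
  qed
  have inv0: "(\<lambda>n. 1 / real (Suc n)) \<longlonglongrightarrow> 0"
    using LIMSEQ_inverse_real_of_nat by (simp add: inverse_eq_divide)
  have "(\<lambda>n. sqrt (8 * (1 / real (Suc n)))) \<longlonglongrightarrow> sqrt (8 * 0)"
    by (intro tendsto_intros inv0)
  then have "Cauchy (\<lambda>n. fst (s n))"
    using gap_s by (intro Cauchy_if_norm_diff_le) auto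
  then obtain w where w: "(\<lambda>n. fst (s n)) \<longlonglongrightarrow> w"
    using Cauchy_convergent convergent_def by blast
  have "(\<lambda>n. \<phi> (s n)) \<longlonglongrightarrow> m"
  proof (rule tendsto_sandwich)
    show "\<forall>\<^sub>F n in sequentially. m \<le> \<phi> (s n)" using m_le sS by simp
    show "\<forall>\<^sub>F n in sequentially. \<phi> (s n) \<le> m + 1 / real (Suc n)"
      using s_less by (intro always_eventually allI less_imp_le)
    show "(\<lambda>n. m + 1 / real (Suc n)) \<longlonglongrightarrow> m"
      using tendsto_add[OF tendsto_const inv0, of m] by simp
  qed simp
  then have "(\<lambda>n. \<phi> (s n) - (norm (fst (s n)))\<^sup>2 / 2) \<longlonglongrightarrow> m - (norm w)\<^sup>2 / 2"
    by (intro tendsto_intros w) auto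
  then have t: "(\<lambda>n. snd (s n)) \<longlonglongrightarrow> m - (norm w)\<^sup>2 / 2"
    by (simp add: \<phi>_def)
  define t where "t = m - (norm w)\<^sup>2 / 2"
  have "(\<lambda>n. (fst (s n), snd (s n))) \<longlonglongrightarrow> (w, t)"
    unfolding t_def by (intro tendsto_Pair w t)
  then have wt: "(w, t) \<in> S"
    using closed_sequentially[OF \<open>closed S\<close>, of s "(w, t)"] sS by simp
  have "t \<le> t' + w \<bullet> (w' - w)" if s': "(w', t') \<in> S" for w' t'
  proof -
    define D W where "D = (norm (w' - w))\<^sup>2" and "W = w \<bullet> (w' - w)"
    have le: "- (\<sigma> * ((norm (w' - w))\<^sup>2 / 2)) \<le> t' - t + w \<bullet> (w' - w)" if "\<sigma> > 0" "\<sigma> \<le> 1" for \<sigma>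
    proof -
      have "(1 - \<sigma>) *\<^sub>R (w, t) + \<sigma> *\<^sub>R (w', t') \<in> S"
        using \<open>convex S\<close> wt s' that by (intro convexD) auto
      from m_le[OF this]
      have "t + (norm w)\<^sup>2 / 2 \<le> (1 - \<sigma>) * t + \<sigma> * t' + (norm ((1 - \<sigma>) *\<^sub>R w + \<sigma> *\<^sub>R w'))\<^sup>2 / 2"
        by (simp add: \<phi>_def t_def)
      also have "(1 - \<sigma>) *\<^sub>R w + \<sigma> *\<^sub>R w' = w + \<sigma> *\<^sub>R (w' - w)"
        by (simp add: algebra_simps)
      also have "(norm (w + \<sigma> *\<^sub>R (w' - w)))\<^sup>2
          = (norm w)\<^sup>2 + 2 * \<sigma> * (w \<bullet> (w' - w)) + \<sigma>\<^sup>2 * (norm (w' - w))\<^sup>2"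
        unfolding power2_norm_eq_inner
        by (simp only: inner_add_left inner_add_right inner_scaleR_left inner_scaleR_right
            inner_commute[of "w' - w" w]) (simp add: power2_eq_square algebra_simps)
      finally have "0 \<le> \<sigma> * (t' - t + W + \<sigma> * (D / 2))"
        unfolding D_def[symmetric] W_def[symmetric]
        by (simp add: power2_eq_square[of \<sigma>] field_simps)
      then show ?thesis using \<open>\<sigma> > 0\<close> by (simp add: zero_le_mult_iff D_def W_def)
    qed
    have "(\<lambda>n. - (1 / real (Suc n) * ((norm (w' - w))\<^sup>2 / 2))) \<longlonglongrightarrow> - (0 * ((norm (w' - w))\<^sup>2 / 2))"
      by (intro tendsto_intros inv0)
    moreover have "- (1 / real (Suc n) * ((norm (w' - w))\<^sup>2 / 2)) \<le> t' - t + w \<bullet> (w' - w)" for n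
      by (rule le) auto
    ultimately have "- (0 * ((norm (w' - w))\<^sup>2 / 2)) \<le> t' - t + w \<bullet> (w' - w)"
      by (intro LIMSEQ_le_const2) auto
    then show ?thesis by simp
  qed
  with wt show ?thesis by (rule that)
qed

lemma min_norm_point:
  fixes C :: "'a::{real_inner, complete_space} set"
  assumes "convex C" "closed C" "C \<noteq> {}"
  obtains w where "w \<in> C" "\<And>w'. w' \<in> C \<Longrightarrow> w \<bullet> w \<le> w \<bullet> w'"
proof (rule strongly_convex_minimiser[of "C \<times> {0}" 0])
  show "convex (C \<times> {0::real})" "closed (C \<times> {0::real})" "C \<times> {0::real} \<noteq> {}"
    using assms by (auto intro: convex_Times closed_Times)
  fix w t assume "(w, t) \<in> C \<times> {0::real}"
    and min: "\<And>w' t'. (w', t') \<in> C \<times> {0::real} \<Longrightarrow> t \<le> t' + w \<bullet> (w' - w)"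
  moreover have "w \<bullet> w \<le> w \<bullet> w'" if "w' \<in> C" for w'
    using min[of w' 0] that \<open>(w, t) \<in> C \<times> {0}\<close> by (simp add: inner_diff_right)
  ultimately show thesis using that by auto
qed auto

text \<open>This takes the place of weak compactness. The points of least norm have increasing, bounded
  norms, and the obtuse angle at a projection turns convergence of the norms into convergence of
  the points.\<close>

lemma nested_closed_convex_common_point:
  fixes C :: "nat \<Rightarrow> 'a::{real_inner, complete_space} set"
  assumes convex: "\<And>n. convex (C n)" and closed: "\<And>n. closed (C n)"
    and anti: "\<And>m n. n \<le> m \<Longrightarrow> C m \<subseteq> C n"
    and meets: "\<And>n. \<exists>z \<in> C n. norm z \<le> M"
  obtains y where "\<And>n. y \<in> C n"
proof -
  have "\<exists>w. w \<in> C n \<and> (\<forall>w' \<in> C n. w \<bullet> w \<le> w \<bullet> w')" for n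
  proof -
    have "C n \<noteq> {}" using meets[of n] by auto
    then obtain w where "w \<in> C n" "\<And>w'. w' \<in> C n \<Longrightarrow> w \<bullet> w \<le> w \<bullet> w'"
      using min_norm_point[OF convex closed] by metis
    then show ?thesis by auto
  qed
  then obtain w where wC: "\<And>n. w n \<in> C n" and w: "\<And>n w'. w' \<in> C n \<Longrightarrow> w n \<bullet> w n \<le> w n \<bullet> w'"
    by metis
  have gap: "(norm (w m - w n))\<^sup>2 \<le> w m \<bullet> w m - w n \<bullet> w n" if "n \<le> m" for m n
    using w[of "w m" n] wC[of m] anti[OF that]
    by (auto simp: power2_norm_eq_inner inner_simps inner_commute)
  have norm_le: "w n \<bullet> w n \<le> M\<^sup>2" for n
  proof -
    obtain z where "z \<in> C n" "norm z \<le> M" using meets by blast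
    then have "norm (w n) * norm (w n) \<le> norm (w n) * norm z"
      using w[of z n] norm_cauchy_schwarz[of "w n" z] by (simp add: dot_square_norm power2_eq_square)
    then have "norm (w n) \<le> M"
      using \<open>norm z \<le> M\<close> by (cases "norm (w n) = 0") (simp_all add: order_trans[OF norm_ge_zero])
    then show ?thesis by (simp add: dot_square_norm power_mono)
  qed
  have "incseq (\<lambda>n. w n \<bullet> w n)"
  proof (rule incseq_SucI)
    fix n
    have "0 \<le> (norm (w (Suc n) - w n))\<^sup>2" by simp
    with gap[of n "Suc n"] show "w n \<bullet> w n \<le> w (Suc n) \<bullet> w (Suc n)" by linarith
  qed
  then obtain L where L: "(\<lambda>n. w n \<bullet> w n) \<longlonglongrightarrow> L" and le_L: "\<And>n. w n \<bullet> w n \<le> L"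
    using incseq_convergent[of "\<lambda>n. w n \<bullet> w n" "M\<^sup>2"] norm_le by metis
  have "Cauchy w"
  proof (rule Cauchy_if_norm_diff_le)
    show "norm (w m - w n) \<le> sqrt (L - w n \<bullet> w n)" if "n \<le> m" for m n
      using gap[OF that] le_L[of m] by (intro real_le_rsqrt) simp
    have "(\<lambda>n. sqrt (L - w n \<bullet> w n)) \<longlonglongrightarrow> sqrt (L - L)" by (intro tendsto_intros L)
    then show "(\<lambda>n. sqrt (L - w n \<bullet> w n)) \<longlonglongrightarrow> 0" by simp
  qed
  then obtain y where y: "w \<longlonglongrightarrow> y" using Cauchy_convergent convergent_def by blast
  have "y \<in> C n" for n
  proof (rule closed_sequentially[OF closed])
    show "(\<lambda>k. w (k + n)) \<longlonglongrightarrow> y" using y by (rule LIMSEQ_ignore_initial_segment)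
    show "w (k + n) \<in> C n" for k using wC anti[of n "k + n"] by auto
  qed
  then show ?thesis by (rule that)
qed

section \<open>Weak convergence without weak compactness\<close>

text \<open>By separation, these are the points that lie in the closed convex hull of every tail of the
  sequence. Unlike weak cluster points, they can be found without extracting subsequences, and
  uniqueness of such a point is still enough for weak convergence.\<close>

definition tail_hull_point :: "(nat \<Rightarrow> 'a::real_inner) \<Rightarrow> 'a \<Rightarrow> bool" where
  "tail_hull_point x y \<longleftrightarrow>
     (\<forall>u b. (\<forall>\<^sub>F k in sequentially. x k \<bullet> u \<le> b) \<longrightarrow> y \<bullet> u \<le> b)"

lemma bounded_has_tail_hull_point:
  fixes x :: "nat \<Rightarrow> 'a::{real_inner, complete_space}"
  assumes "\<And>k. norm (x k) \<le> M"
  obtains y where "tail_hull_point x y"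
proof -
  define C where "C n = closure (convex hull (x ` {n..}))" for n
  have xC: "x n \<in> C n" for n
    unfolding C_def by (rule subsetD[OF closure_subset], rule hull_inc) auto
  obtain y where y: "\<And>n. y \<in> C n"
  proof (rule nested_closed_convex_common_point[of C M])
    show "convex (C n)" "closed (C n)" for n
      by (simp_all add: C_def convex_closure convex_convex_hull)
    show "C m \<subseteq> C n" if "n \<le> m" for m n
      unfolding C_def using that by (intro closure_mono hull_mono image_mono) auto
    show "\<exists>z\<in>C n. norm z \<le> M" for n using xC assms by blast
  qed auto
  have "y \<bullet> u \<le> b" if ev: "\<forall>\<^sub>F k in sequentially. x k \<bullet> u \<le> b" for u b
  proof -
    obtain N where N: "\<forall>k\<ge>N. x k \<bullet> u \<le> b"
      using ev unfolding eventually_sequentially ..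
    have "C N \<subseteq> {z. u \<bullet> z \<le> b}"
      unfolding C_def using N
      by (intro closure_minimal hull_minimal closed_halfspace_le convex_halfspace_le)
        (auto simp: inner_commute)
    then show ?thesis using y[of N] by (auto simp: inner_commute)
  qed
  then show ?thesis by (intro that) (auto simp: tail_hull_point_def)
qed

lemma tail_hull_point_inner_limit:
  assumes "tail_hull_point x y" and "(\<lambda>k. x k \<bullet> u) \<longlonglongrightarrow> l"
  shows "y \<bullet> u = l"
proof (rule antisym)
  show "y \<bullet> u \<le> l"
  proof (rule dense_ge)
    fix b assume "l < b"
    from order_tendstoD(2)[OF assms(2) this] show "y \<bullet> u \<le> b"
      using assms(1) unfolding tail_hull_point_def by (metis (mono_tags, lifting) eventually_mono less_imp_le)
  qed
  show "l \<le> y \<bullet> u"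
  proof (rule dense_le)
    fix b assume "b < l"
    from order_tendstoD(1)[OF assms(2) this] have "\<forall>\<^sub>F k in sequentially. x k \<bullet> (- u) \<le> - b"
      by (auto elim: eventually_mono)
    then have "y \<bullet> (- u) \<le> - b" using assms(1) unfolding tail_hull_point_def by blast
    then show "b \<le> y \<bullet> u" by simp
  qed
qed

text \<open>If some half-space around \<open>y\<close> were left infinitely often, the corresponding subsequence would
  have a tail hull point outside that half-space; but tail hull points of a subsequence are tail
  hull points of the sequence.\<close>

lemma weakly_converges_if_unique_tail_hull_point:
  fixes x :: "nat \<Rightarrow> 'a::{real_inner, complete_space}"
  assumes bounded: "\<And>k. norm (x k) \<le> M"
    and unique: "\<And>y'. tail_hull_point x y' \<Longrightarrow> y' = y"
  shows "weakly_converges x y"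
proof -
  have upper: "\<forall>\<^sub>F k in sequentially. x k \<bullet> u < a" if "y \<bullet> u < a" for u a
  proof (rule ccontr)
    assume "\<not> ?thesis"
    then have "\<forall>n. \<exists>m>n. \<not> x m \<bullet> u < a"
      unfolding eventually_sequentially by (metis less_imp_le Suc_le_eq)
    then have "infinite {k. \<not> x k \<bullet> u < a}" by (auto simp: infinite_nat_iff_unbounded)
    then obtain r :: "nat \<Rightarrow> nat" where r: "strict_mono r" "\<And>n. \<not> x (r n) \<bullet> u < a"
      using infinite_enumerate by blast
    obtain y' where y': "tail_hull_point (x \<circ> r) y'"
      using bounded_has_tail_hull_point[of "x \<circ> r" M] bounded by auto
    have "tail_hull_point x y'"
      using y' eventually_subseq[OF r(1)] unfolding tail_hull_point_def by auto
    then have "y' = y" by (rule unique)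
    moreover have "\<forall>\<^sub>F k in sequentially. (x \<circ> r) k \<bullet> (- u) \<le> - a"
      using r(2) by (auto simp: not_less)
    with y' have "y' \<bullet> (- u) \<le> - a" unfolding tail_hull_point_def by blast
    ultimately show False using that by simp
  qed
  show ?thesis
    unfolding weakly_converges_def
  proof (intro allI order_tendstoI)
    fix u a assume "a < y \<bullet> u"
    then have "\<forall>\<^sub>F k in sequentially. x k \<bullet> (- u) < - a" by (intro upper) simp
    then show "\<forall>\<^sub>F k in sequentially. a < x k \<bullet> u" by simp
  qed (rule upper)
qed

lemma weak_limit_norm_le:
  assumes "weakly_converges x l" and "\<And>k. norm (x k) \<le> B"
  shows "norm l \<le> B"
proof -
  have "l \<bullet> l \<le> B * norm l"
  proof (rule LIMSEQ_le_const2)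
    show "(\<lambda>k. x k \<bullet> l) \<longlonglongrightarrow> l \<bullet> l" using assms(1) by (simp add: weakly_converges_def)
    have "x k \<bullet> l \<le> B * norm l" for k
      using norm_cauchy_schwarz[of "x k" l] mult_right_mono[OF assms(2)[of k], of "norm l"] by simp
    then show "\<exists>N. \<forall>n\<ge>N. x n \<bullet> l \<le> B * norm l" by blast
  qed
  then show ?thesis
    using order_trans[OF norm_ge_zero assms(2)]
    by (cases "l = 0") (auto simp: dot_square_norm power2_eq_square)
qed

lemma weakly_converges_diff:
  assumes "weakly_converges x l" "weakly_converges y m"
  shows "weakly_converges (\<lambda>k. x k - y k) (l - m)"
  using assms by (auto simp: weakly_converges_def inner_diff_left intro: tendsto_diff)

section \<open>Maximally monotone operators and Minty's theorem\<close>

text \<open>A pair that is monotonically related to the whole graph could be added to it, so maximality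
  means that the graph contains all such pairs.\<close>

lemma maximally_monotone_iff:
  "maximally_monotone_op A \<longleftrightarrow>
     (\<forall>p q. q \<in> A p \<longleftrightarrow> (\<forall>a b. b \<in> A a \<longrightarrow> (a - p) \<bullet> (b - q) \<ge> 0))"
  (is "_ \<longleftrightarrow> ?rel")
proof
  assume max: "maximally_monotone_op A"
  then have mono: "monotone_op A" by (simp add: maximally_monotone_op_def)
  have "q \<in> A p" if rel: "\<And>a b. b \<in> A a \<Longrightarrow> (a - p) \<bullet> (b - q) \<ge> 0" for p q
  proof (rule ccontr)
    assume "q \<notin> A p"
    define B where "B = A(p := insert q (A p))"
    have mem: "v \<in> B y \<longleftrightarrow> v \<in> A y \<or> y = p \<and> v = q" for y v by (auto simp: B_def)
    have "(p - a) \<bullet> (q - b) \<ge> 0" if "b \<in> A a" for a b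
      using rel[OF that] by (metis inner_minus_left inner_minus_right minus_diff_eq minus_minus)
    then have "monotone_op B"
      using mono rel unfolding monotone_op_def mem by auto
    moreover have "gra A \<subset> gra B"
      using \<open>q \<notin> A p\<close> by (auto simp: gra_def mem)
    ultimately show False using max by (auto simp: maximally_monotone_op_def)
  qed
  with mono show ?rel unfolding monotone_op_def by blast
next
  assume rel: ?rel
  then have "monotone_op A" unfolding monotone_op_def by blast
  moreover have "gra B \<subseteq> gra A" if "monotone_op B" "gra A \<subseteq> gra B" for B
  proof -
    have sub: "b \<in> B a" if "b \<in> A a" for a b
      using \<open>gra A \<subseteq> gra B\<close> that by (auto simp: gra_def)
    have "q \<in> A p" if "q \<in> B p" for p q
      using rel \<open>monotone_op B\<close> that sub unfolding monotone_op_def by blast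
    then show ?thesis by (auto simp: gra_def)
  qed
  ultimately show "maximally_monotone_op A" unfolding maximally_monotone_op_def by blast
qed

lemma maximally_monotoneI_related:
  assumes "maximally_monotone_op A" "\<And>a b. b \<in> A a \<Longrightarrow> (a - p) \<bullet> (b - q) \<ge> 0"
  shows "q \<in> A p"
  using assms maximally_monotone_iff by blast

lemma maximally_monotoneD:
  assumes "maximally_monotone_op A" "u \<in> A x" "v \<in> A y"
  shows "(x - y) \<bullet> (u - v) \<ge> 0"
  using assms by (auto simp: maximally_monotone_op_def monotone_op_def)

text \<open>Solving \<open>z \<in> p + \<gamma> A p\<close> means solving \<open>- p \<in> B p\<close> for the transformed operator \<open>B\<close>, so the
  resolvents reduce to the special case of Minty's theorem below.\<close>

lemma maximally_monotone_affine:
  fixes A :: "'a::real_inner set_op"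
  assumes "maximally_monotone_op A" "\<gamma> > 0"
  shows "maximally_monotone_op (\<lambda>a. (\<lambda>b. \<gamma> *\<^sub>R b - z) ` A a)"
  unfolding maximally_monotone_iff
proof (intro allI)
  fix p q
  define q' where "q' = (1 / \<gamma>) *\<^sub>R (q + z)"
  have q: "q = \<gamma> *\<^sub>R q' - z" using \<open>\<gamma> > 0\<close> by (simp add: q'_def)
  have "q \<in> (\<lambda>b. \<gamma> *\<^sub>R b - z) ` A p \<longleftrightarrow> q' \<in> A p"
    using \<open>\<gamma> > 0\<close> by (auto simp: q)
  also have "\<dots> \<longleftrightarrow> (\<forall>a b. b \<in> A a \<longrightarrow> (a - p) \<bullet> (b - q') \<ge> 0)"
    using assms(1) maximally_monotone_iff by blast
  also have "\<dots> \<longleftrightarrow> (\<forall>a b. b \<in> A a \<longrightarrow> (a - p) \<bullet> ((\<gamma> *\<^sub>R b - z) - q) \<ge> 0)"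
  proof -
    have "(a - p) \<bullet> ((\<gamma> *\<^sub>R b - z) - q) = \<gamma> * ((a - p) \<bullet> (b - q'))" for a b
      by (simp add: q algebra_simps)
    then show ?thesis using \<open>\<gamma> > 0\<close> by (simp add: zero_le_mult_iff)
  qed
  finally show "q \<in> (\<lambda>b. \<gamma> *\<^sub>R b - z) ` A p \<longleftrightarrow>
      (\<forall>a b. b \<in> (\<lambda>b. \<gamma> *\<^sub>R b - z) ` A a \<longrightarrow> (a - p) \<bullet> (b - q) \<ge> 0)"
    by auto
qed

text \<open>Minty's theorem at the origin. The set \<open>S\<close> is the epigraph of the Fitzpatrick function
  \<open>F (p, q) = sup {p \<bullet> b + a \<bullet> q - a \<bullet> b | b \<in> A a}\<close>. Maximality gives
  \<open>F (p, q) \<ge> p \<bullet> q\<close>, so \<open>F + \<parallel>\<cdot>\<parallel>\<^sup>2 / 2\<close> is bounded below by \<open>0\<close> and has a minimiser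
  \<open>(p, q)\<close>. Its optimality condition, tested on the graph of \<open>A\<close>, where \<open>F (a, b) = a \<bullet> b\<close>, says
  \<open>(a + q) \<bullet> (b + p) \<ge> \<parallel>p + q\<parallel>\<^sup>2\<close>. Hence \<open>(- q, - p)\<close> belongs to the graph, and testing with this
  very pair gives \<open>q = - p\<close>.\<close>

lemma Minty_zero:
  fixes A :: "'a::{real_inner, complete_space} set_op"
  assumes max: "maximally_monotone_op A"
  obtains p where "- p \<in> A p"
proof -
  define S :: "(('a \<times> 'a) \<times> real) set" where
    "S = (\<Inter>a. \<Inter>b\<in>A a. {s. fst (fst s) \<bullet> b + a \<bullet> snd (fst s) - a \<bullet> b \<le> snd s})"
  have S_iff: "((p, q), t) \<in> S \<longleftrightarrow> (\<forall>a b. b \<in> A a \<longrightarrow> p \<bullet> b + a \<bullet> q - a \<bullet> b \<le> t)" for p q t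
    by (auto simp: S_def)
  have graph: "((a, b), a \<bullet> b) \<in> S" if "b \<in> A a" for a b
    unfolding S_iff
  proof (intro allI impI)
    fix a' b' assume "b' \<in> A a'"
    from maximally_monotoneD[OF max that this]
    show "a \<bullet> b' + a' \<bullet> b - a' \<bullet> b' \<le> a \<bullet> b" by (simp add: inner_simps)
  qed
  have above: "p \<bullet> q \<le> t" if s: "((p, q), t) \<in> S" for p q t
  proof (rule ccontr)
    assume "\<not> p \<bullet> q \<le> t"
    have "q \<in> A p"
    proof (rule maximally_monotoneI_related[OF max])
      fix a b assume "b \<in> A a"
      with s \<open>\<not> p \<bullet> q \<le> t\<close> show "(a - p) \<bullet> (b - q) \<ge> 0"
        unfolding S_iff by (force simp: inner_simps)
    qed
    with s have "p \<bullet> q + p \<bullet> q - p \<bullet> q \<le> t" unfolding S_iff by blast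
    with \<open>\<not> p \<bullet> q \<le> t\<close> show False by simp
  qed
  have sum_sq: "(norm (p + q))\<^sup>2 = p \<bullet> p + 2 * (p \<bullet> q) + q \<bullet> q" for p q :: 'a
    by (simp add: power2_norm_eq_inner inner_simps inner_commute)
  obtain w t where wt: "(w, t) \<in> S"
    and opt: "\<And>w' t'. (w', t') \<in> S \<Longrightarrow> t \<le> t' + w \<bullet> (w' - w)"
  proof (rule strongly_convex_minimiser[of S 0])
    show "closed S"
      unfolding S_def by (intro closed_INT ballI closed_Collect_le continuous_intros)
    show "convex S"
      unfolding S_def
    proof (intro convex_INT)
      fix a b
      show "convex {s :: ('a \<times> 'a) \<times> real. fst (fst s) \<bullet> b + a \<bullet> snd (fst s) - a \<bullet> b \<le> snd s}"
      proof (rule convexI)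
        fix s s' :: "('a \<times> 'a) \<times> real" and \<sigma> \<tau> :: real
        assume "s \<in> {s. fst (fst s) \<bullet> b + a \<bullet> snd (fst s) - a \<bullet> b \<le> snd s}"
          "s' \<in> {s. fst (fst s) \<bullet> b + a \<bullet> snd (fst s) - a \<bullet> b \<le> snd s}"
          "0 \<le> \<sigma>" "0 \<le> \<tau>" "\<sigma> + \<tau> = 1"
        then have "\<sigma> * (fst (fst s) \<bullet> b + a \<bullet> snd (fst s) - a \<bullet> b)
            + \<tau> * (fst (fst s') \<bullet> b + a \<bullet> snd (fst s') - a \<bullet> b) \<le> \<sigma> * snd s + \<tau> * snd s'"
          by (intro add_mono mult_left_mono) auto
        moreover have "\<sigma> * (a \<bullet> b) + \<tau> * (a \<bullet> b) = a \<bullet> b"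
          using \<open>\<sigma> + \<tau> = 1\<close> by (metis distrib_right mult_1)
        ultimately show "\<sigma> *\<^sub>R s + \<tau> *\<^sub>R s'
            \<in> {s. fst (fst s) \<bullet> b + a \<bullet> snd (fst s) - a \<bullet> b \<le> snd s}"
          by (simp add: inner_simps algebra_simps)
      qed
    qed
    show "S \<noteq> {}"
    proof (cases "\<exists>a b. b \<in> A a")
      case True
      then show ?thesis using graph by blast
    next
      case False
      then have "((0, 0), 0) \<in> S" by (simp add: S_iff)
      then show ?thesis by blast
    qed
    show "0 \<le> t + (norm w)\<^sup>2 / 2" if "(w, t) \<in> S" for w t
    proof -
      obtain p q where w: "w = (p, q)" by (cases w)
      have "0 \<le> p \<bullet> p + 2 * (p \<bullet> q) + q \<bullet> q" by (metis sum_sq zero_le_power2)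
      then show ?thesis
        using above[of p q t] that unfolding w power2_norm_eq_inner by (simp add: field_simps)
    qed
    fix w t assume "(w, t) \<in> S" "\<And>w' t'. (w', t') \<in> S \<Longrightarrow> t \<le> t' + w \<bullet> (w' - w)"
    then show thesis by (rule that)
  qed
  obtain p q where w: "w = (p, q)" by (cases w)
  have key: "(norm (p + q))\<^sup>2 \<le> (a + q) \<bullet> (b + p)" if "b \<in> A a" for a b
  proof -
    have "p \<bullet> q \<le> a \<bullet> b + p \<bullet> (a - p) + q \<bullet> (b - q)"
      using opt[OF graph[OF that]] above[of p q t] wt by (simp add: w)
    then show ?thesis unfolding sum_sq by (simp add: inner_simps inner_commute)
  qed
  have mem: "- p \<in> A (- q)"
  proof (rule maximally_monotoneI_related[OF max])
    fix a b assume "b \<in> A a"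
    from order_trans[OF zero_le_power2 key[OF this]]
    show "(a - - q) \<bullet> (b - - p) \<ge> 0" by simp
  qed
  from key[OF this] have "p + q = 0" by simp
  then have "p = - q" by (simp only: eq_neg_iff_add_eq_0)
  with mem have "- p \<in> A p" by (simp only:)
  then show ?thesis by (rule that)
qed

section \<open>Resolvents\<close>

lemma resolvent_eq_iff:
  fixes A :: "'a::{real_inner, complete_space} set_op"
  assumes max: "maximally_monotone_op A" and "\<gamma> > 0"
  shows "resolvent (scale_op \<gamma> A) z = p \<longleftrightarrow> (1 / \<gamma>) *\<^sub>R (z - p) \<in> A p"
proof -
  have mem: "p \<in> resolvent_op (scale_op \<gamma> A) z \<longleftrightarrow> (1 / \<gamma>) *\<^sub>R (z - p) \<in> A p" for p
  proof
    assume "p \<in> resolvent_op (scale_op \<gamma> A) z"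
    then show "(1 / \<gamma>) *\<^sub>R (z - p) \<in> A p"
      using \<open>\<gamma> > 0\<close>
      by (auto simp: resolvent_op_def inv_op_def add_op_def id_op_def scale_op_def)
  next
    assume "(1 / \<gamma>) *\<^sub>R (z - p) \<in> A p"
    then have "z - p \<in> scale_op \<gamma> A p"
      using \<open>\<gamma> > 0\<close> by (auto simp: scale_op_def intro!: image_eqI)
    then show "p \<in> resolvent_op (scale_op \<gamma> A) z"
      by (auto simp: resolvent_op_def inv_op_def add_op_def id_op_def intro!: exI[of _ "z - p"])
  qed
  obtain p0 where "- p0 \<in> (\<lambda>b. \<gamma> *\<^sub>R b - z) ` A p0"
    using Minty_zero[OF maximally_monotone_affine[OF assms, of z]] by blast
  then obtain b where b: "b \<in> A p0" "- p0 = \<gamma> *\<^sub>R b - z" by blast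
  have "z - p0 = \<gamma> *\<^sub>R b" using b(2) by (simp add: algebra_simps)
  then have p0: "(1 / \<gamma>) *\<^sub>R (z - p0) \<in> A p0" using b(1) \<open>\<gamma> > 0\<close> by simp
  have unique: "p' = p0" if "(1 / \<gamma>) *\<^sub>R (z - p') \<in> A p'" for p'
  proof -
    have "(p' - p0) \<bullet> ((1 / \<gamma>) *\<^sub>R (z - p') - (1 / \<gamma>) *\<^sub>R (z - p0)) = - ((norm (p' - p0))\<^sup>2 / \<gamma>)"
      unfolding power2_norm_eq_inner
      by (simp add: inner_simps inner_commute diff_divide_distrib add_divide_distrib)
    with maximally_monotoneD[OF max that p0] \<open>\<gamma> > 0\<close> show ?thesis
      by (simp add: divide_le_0_iff)
  qed
  have "resolvent_op (scale_op \<gamma> A) z = {p0}" using p0 unique mem by blast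
  then have "resolvent (scale_op \<gamma> A) z = p0" by (simp add: resolvent_def)
  with p0 unique show ?thesis by blast
qed

lemma resolvent_mem:
  fixes A :: "'a::{real_inner, complete_space} set_op"
  assumes "maximally_monotone_op A" "\<gamma> > 0"
  shows "(1 / \<gamma>) *\<^sub>R (z - resolvent (scale_op \<gamma> A) z) \<in> A (resolvent (scale_op \<gamma> A) z)"
  by (rule iffD1[OF resolvent_eq_iff[OF assms] refl])

lemma resolvent_fixed_iff_zer:
  fixes A :: "'a::{real_inner, complete_space} set_op"
  assumes "maximally_monotone_op A" "\<gamma> > 0"
  shows "resolvent (scale_op \<gamma> A) z = z \<longleftrightarrow> z \<in> zer A"
  unfolding resolvent_eq_iff[OF assms] by (simp add: zer_def)

definition firmly_nonexpansive :: "('a::real_inner \<Rightarrow> 'a) \<Rightarrow> bool" where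
  "firmly_nonexpansive J \<longleftrightarrow> (\<forall>x y. (J x - J y) \<bullet> ((x - J x) - (y - J y)) \<ge> 0)"

lemma firmly_nonexpansive_resolvent:
  fixes A :: "'a::{real_inner, complete_space} set_op"
  assumes "maximally_monotone_op A" "\<gamma> > 0"
  shows "firmly_nonexpansive (resolvent (scale_op \<gamma> A))"
  unfolding firmly_nonexpansive_def
proof (intro allI)
  fix x y
  let ?J = "resolvent (scale_op \<gamma> A)"
  have "0 \<le> (?J x - ?J y) \<bullet> ((1 / \<gamma>) *\<^sub>R (x - ?J x) - (1 / \<gamma>) *\<^sub>R (y - ?J y))"
    by (rule maximally_monotoneD[OF assms(1) resolvent_mem[OF assms] resolvent_mem[OF assms]])
  then show "(?J x - ?J y) \<bullet> ((x - ?J x) - (y - ?J y)) \<ge> 0"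
    using \<open>\<gamma> > 0\<close> by (simp flip: scaleR_diff_right add: zero_le_divide_iff)
qed

text \<open>Write \<open>p\<close> and \<open>q\<close> for the resolvents of \<open>c A\<close> and \<open>\<gamma> A\<close> at \<open>z\<close>. Monotonicity between the graph
  points over \<open>p\<close> and \<open>q\<close> gives \<open>\<parallel>p - q\<parallel>\<^sup>2 \<le> (\<gamma> / c - 1) (p - q) \<bullet> (z - p)\<close>. Using the residual at \<open>p\<close>
  produces the factor \<open>\<gamma> / c - 1\<close>; the residual at \<open>q\<close> would produce \<open>1 - c / \<gamma>\<close>. It is the former that is
  summable along the iteration.\<close>

lemma resolvent_parameter_change:
  fixes A :: "'a::{real_inner, complete_space} set_op"
  assumes max: "maximally_monotone_op A" and "c > 0" "\<gamma> > 0"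
  shows "norm (resolvent (scale_op \<gamma> A) z - resolvent (scale_op c A) z)
    \<le> \<bar>\<gamma> / c - 1\<bar> * norm (z - resolvent (scale_op c A) z)"
proof -
  define p where "p = resolvent (scale_op c A) z"
  define q where "q = resolvent (scale_op \<gamma> A) z"
  define d where "d = p - q"
  have "0 \<le> (p - q) \<bullet> ((1 / c) *\<^sub>R (z - p) - (1 / \<gamma>) *\<^sub>R (z - q))"
    unfolding p_def q_def
    by (rule maximally_monotoneD[OF max resolvent_mem[OF max \<open>c > 0\<close>] resolvent_mem[OF max \<open>\<gamma> > 0\<close>]])
  then have "0 \<le> \<gamma> * ((p - q) \<bullet> ((1 / c) *\<^sub>R (z - p) - (1 / \<gamma>) *\<^sub>R (z - q)))"
    using \<open>\<gamma> > 0\<close> by simp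
  also have "\<dots> = d \<bullet> (\<gamma> *\<^sub>R ((1 / c) *\<^sub>R (z - p) - (1 / \<gamma>) *\<^sub>R (z - q)))"
    by (simp add: d_def)
  also have "\<gamma> *\<^sub>R ((1 / c) *\<^sub>R (z - p) - (1 / \<gamma>) *\<^sub>R (z - q)) = (\<gamma> / c - 1) *\<^sub>R (z - p) - d"
    using \<open>\<gamma> > 0\<close> by (simp add: d_def algebra_simps)
  also have "d \<bullet> ((\<gamma> / c - 1) *\<^sub>R (z - p) - d) = (\<gamma> / c - 1) * (d \<bullet> (z - p)) - d \<bullet> d"
    by (simp add: inner_diff_right)
  finally have "d \<bullet> d \<le> (\<gamma> / c - 1) * (d \<bullet> (z - p))" by simp
  also have "\<dots> \<le> \<bar>\<gamma> / c - 1\<bar> * \<bar>d \<bullet> (z - p)\<bar>"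
    by (metis abs_ge_self abs_mult)
  also have "\<dots> \<le> \<bar>\<gamma> / c - 1\<bar> * (norm d * norm (z - p))"
    by (intro mult_left_mono Cauchy_Schwarz_ineq2) auto
  finally have "norm d * norm d \<le> norm d * (\<bar>\<gamma> / c - 1\<bar> * norm (z - p))"
    by (simp add: dot_square_norm power2_eq_square ac_simps)
  then have "norm d \<le> \<bar>\<gamma> / c - 1\<bar> * norm (z - p)"
    by (cases "norm d = 0") auto
  then show ?thesis by (simp add: d_def p_def q_def norm_minus_commute)
qed

section \<open>Relaxed iterations of a firmly nonexpansive map\<close>

text \<open>With \<open>d = x - y\<close> and \<open>g\<close> the difference of the residuals, firm nonexpansiveness reads
  \<open>d \<bullet> g \<ge> \<parallel>g\<parallel>\<^sup>2\<close>, while the relaxed images differ by \<open>d - l g\<close>.\<close>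

lemma relaxation_contracts:
  assumes "firmly_nonexpansive J" "l \<ge> 0"
  shows "(norm (((1 - l) *\<^sub>R x + l *\<^sub>R J x) - ((1 - l) *\<^sub>R y + l *\<^sub>R J y)))\<^sup>2
    \<le> (norm (x - y))\<^sup>2 - l * (2 - l) * (norm ((x - J x) - (y - J y)))\<^sup>2"
proof -
  define d g where "d = x - y" and "g = (x - J x) - (y - J y)"
  have "J x - J y = d - g" by (simp add: d_def g_def)
  then have "0 \<le> (d - g) \<bullet> g"
    using assms(1) unfolding firmly_nonexpansive_def g_def by metis
  then have "g \<bullet> g \<le> d \<bullet> g" by (simp add: inner_diff_left)
  then have "l * (g \<bullet> g) \<le> l * (d \<bullet> g)" using \<open>l \<ge> 0\<close> by (rule mult_left_mono)
  moreover have "((1 - l) *\<^sub>R x + l *\<^sub>R J x) - ((1 - l) *\<^sub>R y + l *\<^sub>R J y) = d - l *\<^sub>R g"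
    by (simp add: d_def g_def algebra_simps)
  moreover have "(norm (d - l *\<^sub>R g))\<^sup>2 = d \<bullet> d - 2 * (l * (d \<bullet> g)) + l * (l * (g \<bullet> g))"
    unfolding power2_norm_eq_inner by (simp add: inner_simps inner_commute)
  moreover have "l * (2 - l) * (norm g)\<^sup>2 = 2 * (l * (g \<bullet> g)) - l * (l * (g \<bullet> g))"
    unfolding power2_norm_eq_inner by (simp add: algebra_simps)
  ultimately show ?thesis
    unfolding d_def[symmetric] g_def[symmetric]
    by (simp add: power2_norm_eq_inner[of d])
qed

lemma relaxation_nonexpansive:
  assumes "firmly_nonexpansive J" "l \<in> {0<..2}"
  shows "norm (((1 - l) *\<^sub>R x + l *\<^sub>R J x) - ((1 - l) *\<^sub>R y + l *\<^sub>R J y)) \<le> norm (x - y)"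
proof -
  have "0 \<le> l * (2 - l) * (norm ((x - J x) - (y - J y)))\<^sup>2" using assms(2) by simp
  moreover have "l \<ge> 0" using assms(2) by simp
  ultimately have "(norm (((1 - l) *\<^sub>R x + l *\<^sub>R J x) - ((1 - l) *\<^sub>R y + l *\<^sub>R J y)))\<^sup>2
      \<le> (norm (x - y))\<^sup>2"
    using relaxation_contracts[OF assms(1), of l x y] by linarith
  then show ?thesis by (rule power2_le_imp_le) (rule norm_ge_zero)
qed

text \<open>Here \<open>x - y = l g\<close> with \<open>g\<close> the residual at \<open>x\<close>. If \<open>h\<close> is the residual at \<open>y\<close>, firm
  nonexpansiveness reads \<open>\<parallel>g - h\<parallel>\<^sup>2 \<le> l (g \<bullet> (g - h))\<close>; replacing \<open>l\<close> by its maximum \<open>2\<close> and expanding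
  leaves \<open>\<parallel>h\<parallel>\<^sup>2 \<le> \<parallel>g\<parallel>\<^sup>2\<close>.\<close>

lemma relaxation_residual_le:
  assumes "firmly_nonexpansive J" "l \<in> {0<..2}" and y: "y = (1 - l) *\<^sub>R x + l *\<^sub>R J x"
  shows "norm (y - J y) \<le> norm (x - J x)"
proof -
  define g h where "g = x - J x" and "h = y - J y"
  have "x - y = l *\<^sub>R g" by (simp add: y g_def algebra_simps)
  moreover have "J x - J y = (x - y) - (g - h)" by (simp add: g_def h_def)
  ultimately have "0 \<le> (l *\<^sub>R g - (g - h)) \<bullet> (g - h)"
    using assms(1) unfolding firmly_nonexpansive_def g_def h_def by metis
  then have le: "(g - h) \<bullet> (g - h) \<le> l * (g \<bullet> (g - h))" by (simp add: inner_diff_left)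
  then have "0 \<le> l * (g \<bullet> (g - h))" using inner_ge_zero order_trans by blast
  then have "0 \<le> g \<bullet> (g - h)" using assms(2) by (simp add: zero_le_mult_iff)
  then have "l * (g \<bullet> (g - h)) \<le> 2 * (g \<bullet> (g - h))" using assms(2) by (intro mult_right_mono) auto
  with le have "h \<bullet> h \<le> g \<bullet> g" by (simp add: inner_simps inner_commute)
  then show ?thesis by (simp add: g_def h_def norm_le)
qed

lemma filterlim_sum_shift:
  fixes f :: "nat \<Rightarrow> real"
  assumes "filterlim (\<lambda>n. \<Sum>k<n. f k) at_top sequentially"
  shows "filterlim (\<lambda>n. \<Sum>k<n. f (k + i)) at_top sequentially"
proof -
  have "(\<Sum>k<n + i. f k) = (\<Sum>k<i. f k) + (\<Sum>k<n. f (k + i))" for n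
    by (induction n) auto
  then have eq: "(\<lambda>n. \<Sum>k<n. f (k + i)) = (\<lambda>n. - (\<Sum>k<i. f k) + (\<Sum>k<n + i. f k))" by auto
  show ?thesis
    unfolding eq
    by (rule filterlim_tendsto_add_at_top[OF tendsto_const])
      (rule filterlim_compose[OF assms filterlim_add_const_nat_at_top])
qed

text \<open>Weak limits of \<open>\<xi>\<close> along which the residual vanishes are zeros, with tail hull points in place
  of weak limits: monotonicity against a fixed pair \<open>(a, b)\<close> of the graph confines \<open>\<xi>\<close>, up to an
  error tending to \<open>0\<close>, to a half-space.\<close>

lemma tail_hull_point_zer:
  fixes A :: "'a::{real_inner, complete_space} set_op"
  assumes max: "maximally_monotone_op A" and "c > 0"
    and res: "(\<lambda>k. \<xi> k - resolvent (scale_op c A) (\<xi> k)) \<longlonglongrightarrow> 0"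
    and bounded: "\<And>k. norm (\<xi> k) \<le> M"
    and y: "tail_hull_point \<xi> y"
  shows "y \<in> zer A"
proof -
  define v where "v k = \<xi> k - resolvent (scale_op c A) (\<xi> k)" for k
  have v0: "v \<longlonglongrightarrow> 0" using res by (simp add: v_def[abs_def])
  have p: "(1 / c) *\<^sub>R v k \<in> A (\<xi> k - v k)" for k
    using resolvent_mem[OF max \<open>c > 0\<close>, of "\<xi> k"] by (simp add: v_def)
  have "0 \<in> A y"
  proof (rule maximally_monotoneI_related[OF max])
    fix a b assume ab: "b \<in> A a"
    have "y \<bullet> b \<le> a \<bullet> b + \<epsilon>" if "\<epsilon> > 0" for \<epsilon>
    proof -
      \<comment> \<open>A Cauchy-Schwarz bound for all terms of the monotonicity inequality that contain \<open>v k\<close>.\<close>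
      define err where
        "err k = norm (v k) * norm b + (M + norm (v k) + norm a) * ((1 / c) * norm (v k))" for k
      have "err \<longlonglongrightarrow> norm (0::'a) * norm b + (M + norm (0::'a) + norm a) * ((1 / c) * norm (0::'a))"
        unfolding err_def by (intro tendsto_intros v0)
      then have ev: "\<forall>\<^sub>F k in sequentially. err k < \<epsilon>"
        using that by (intro order_tendstoD(2)[of err 0]) auto
      have le: "\<xi> k \<bullet> b \<le> a \<bullet> b + err k" for k
      proof -
        have "0 \<le> (\<xi> k - v k - a) \<bullet> ((1 / c) *\<^sub>R v k - b)"
          by (rule maximally_monotoneD[OF max p ab])
        then have "\<xi> k \<bullet> b \<le> a \<bullet> b + v k \<bullet> b + (\<xi> k - v k - a) \<bullet> ((1 / c) *\<^sub>R v k)"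
          by (simp add: inner_diff_left inner_diff_right algebra_simps)
        moreover have "v k \<bullet> b \<le> norm (v k) * norm b" by (rule norm_cauchy_schwarz)
        moreover have "(\<xi> k - v k - a) \<bullet> ((1 / c) *\<^sub>R v k)
            \<le> (M + norm (v k) + norm a) * ((1 / c) * norm (v k))"
        proof (rule order_trans[OF norm_cauchy_schwarz mult_mono])
          show "norm (\<xi> k - v k - a) \<le> M + norm (v k) + norm a"
            using norm_triangle_ineq4[of "\<xi> k - v k" a] norm_triangle_ineq4[of "\<xi> k" "v k"]
              bounded[of k] by simp
          then show "0 \<le> M + norm (v k) + norm a" by (rule order_trans[OF norm_ge_zero])
        qed (use \<open>c > 0\<close> in auto)
        ultimately show ?thesis by (simp add: err_def)
      qed
      from ev have "\<forall>\<^sub>F k in sequentially. \<xi> k \<bullet> b \<le> a \<bullet> b + \<epsilon>"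
      proof (rule eventually_mono)
        show "\<xi> k \<bullet> b \<le> a \<bullet> b + \<epsilon>" if "err k < \<epsilon>" for k using le[of k] that by linarith
      qed
      then show ?thesis using y unfolding tail_hull_point_def by blast
    qed
    then have "y \<bullet> b \<le> a \<bullet> b" by (rule field_le_epsilon)
    then show "(a - y) \<bullet> (b - 0) \<ge> 0" by (simp add: inner_diff_left)
  qed
  then show ?thesis by (simp add: zer_def)
qed

text \<open>The error-free case. The distances to every zero decrease and the residuals decrease too, so
  the divergent weights force the residuals to \<open>0\<close>; hence all tail hull points are zeros. Two of them
  coincide because \<open>\<xi> k \<bullet> (y - y')\<close>, a combination of squared distances to zeros, converges.\<close>

lemma exact_relaxed_iteration_weakly_converges:
  fixes A :: "'a::{real_inner, complete_space} set_op"
  assumes max: "maximally_monotone_op A" and "c > 0" and "zer A \<noteq> {}"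
    and lam: "\<And>k. lam k \<in> {0<..2::real}"
    and step: "\<And>k. \<xi> (Suc k) = (1 - lam k) *\<^sub>R \<xi> k + lam k *\<^sub>R resolvent (scale_op c A) (\<xi> k)"
    and div: "filterlim (\<lambda>n. \<Sum>k<n. lam k * (2 - lam k)) at_top sequentially"
  obtains y where "y \<in> zer A" "weakly_converges \<xi> y"
proof -
  define J where "J = resolvent (scale_op c A)"
  have firm: "firmly_nonexpansive J"
    unfolding J_def by (rule firmly_nonexpansive_resolvent[OF max \<open>c > 0\<close>])
  have step: "\<xi> (Suc k) = (1 - lam k) *\<^sub>R \<xi> k + lam k *\<^sub>R J (\<xi> k)" for k
    by (simp add: step J_def)
  have fejer: "(norm (\<xi> (Suc k) - z))\<^sup>2
      \<le> (norm (\<xi> k - z))\<^sup>2 - lam k * (2 - lam k) * (norm (\<xi> k - J (\<xi> k)))\<^sup>2"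
    if "z \<in> zer A" for z k
  proof -
    have "J z = z" using that by (simp add: J_def resolvent_fixed_iff_zer[OF max \<open>c > 0\<close>])
    then have "(1 - lam k) *\<^sub>R z + lam k *\<^sub>R J z = z" by (simp add: algebra_simps)
    with \<open>J z = z\<close> show ?thesis
      using relaxation_contracts[OF firm, of "lam k" "\<xi> k" z] lam[of k] by (simp add: step)
  qed
  have weight: "0 \<le> lam k * (2 - lam k)" for k using lam[of k] by simp
  have dist_dec: "decseq (\<lambda>k. (norm (\<xi> k - z))\<^sup>2)" if "z \<in> zer A" for z
  proof (rule decseq_SucI)
    fix k
    have "0 \<le> lam k * (2 - lam k) * (norm (\<xi> k - J (\<xi> k)))\<^sup>2" using weight by simp
    then show "(norm (\<xi> (Suc k) - z))\<^sup>2 \<le> (norm (\<xi> k - z))\<^sup>2"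
      using fejer[OF that, of k] by linarith
  qed
  obtain z where z: "z \<in> zer A" using \<open>zer A \<noteq> {}\<close> by blast
  have bounded: "norm (\<xi> k) \<le> norm z + norm (\<xi> 0 - z)" for k
  proof -
    have "norm (\<xi> k - z) \<le> norm (\<xi> 0 - z)"
      by (rule power2_le_imp_le[OF _ norm_ge_zero]) (rule decseqD[OF dist_dec[OF z] le0])
    then show ?thesis using norm_triangle_ineq[of z "\<xi> k - z"] by simp
  qed
  have res: "(\<lambda>k. \<xi> k - J (\<xi> k)) \<longlonglongrightarrow> 0"
  proof -
    define g where "g k = (norm (\<xi> k - J (\<xi> k)))\<^sup>2" for k
    define s where "s n = (\<Sum>k<n. lam k * (2 - lam k))" for n
    have "decseq g"
      unfolding g_def
      by (intro decseq_SucI power_mono relaxation_residual_le[OF firm lam step] norm_ge_zero)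
    have "(\<Sum>k<n. lam k * (2 - lam k) * g k) \<le> (norm (\<xi> 0 - z))\<^sup>2 - (norm (\<xi> n - z))\<^sup>2" for n
    proof (induction n)
      case (Suc n)
      then show ?case using fejer[OF z, of n] unfolding g_def sum.lessThan_Suc by linarith
    qed simp
    then have total: "(\<Sum>k<n. lam k * (2 - lam k) * g k) \<le> (norm (\<xi> 0 - z))\<^sup>2" for n
      by (rule order_trans) simp
    \<comment> \<open>Since \<open>g\<close> decreases, its last value can be pulled out of the telescoped sum.\<close>
    have gs: "g n * s n \<le> (norm (\<xi> 0 - z))\<^sup>2" for n
    proof -
      have "g n * s n = (\<Sum>k<n. lam k * (2 - lam k) * g n)"
        unfolding s_def mult.commute[of "g n"] sum_distrib_right ..
      also have "\<dots> \<le> (\<Sum>k<n. lam k * (2 - lam k) * g k)"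
        by (intro sum_mono mult_left_mono weight decseqD[OF \<open>decseq g\<close>]) simp
      finally show ?thesis using total[of n] by (rule order_trans)
    qed
    have s_top: "filterlim s at_top sequentially" using div by (simp add: s_def[abs_def])
    have "g \<longlonglongrightarrow> 0"
    proof (rule tendsto_sandwich)
      show "\<forall>\<^sub>F n in sequentially. 0 \<le> g n" by (simp add: g_def)
      have "\<forall>\<^sub>F n in sequentially. 0 < s n" using s_top by (simp add: filterlim_at_top_dense)
      then show "\<forall>\<^sub>F n in sequentially. g n \<le> (norm (\<xi> 0 - z))\<^sup>2 / s n"
        using gs by (auto elim!: eventually_mono simp: pos_le_divide_eq)
      show "(\<lambda>n. (norm (\<xi> 0 - z))\<^sup>2 / s n) \<longlonglongrightarrow> 0"
        by (rule real_tendsto_divide_at_top[OF tendsto_const s_top])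
    qed simp
    then have "(\<lambda>n. sqrt (g n)) \<longlonglongrightarrow> sqrt 0" by (rule tendsto_real_sqrt)
    then have "(\<lambda>k. norm (\<xi> k - J (\<xi> k))) \<longlonglongrightarrow> 0" by (simp add: g_def)
    then show ?thesis by (rule tendsto_norm_zero_cancel)
  qed
  have hull_zer: "y \<in> zer A" if "tail_hull_point \<xi> y" for y
    using tail_hull_point_zer[OF max \<open>c > 0\<close> _ bounded that] res by (simp add: J_def)
  have unique: "y' = y" if y: "tail_hull_point \<xi> y" and y': "tail_hull_point \<xi> y'" for y y'
  proof -
    have conv: "convergent (\<lambda>k. (norm (\<xi> k - z))\<^sup>2)" if "z \<in> zer A" for z
      using decseq_convergent[OF dist_dec[OF that], of 0] zero_le_power2 convergent_def by metis
    have "convergent (\<lambda>k. (norm (\<xi> k - y'))\<^sup>2 - (norm (\<xi> k - y))\<^sup>2)"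
      by (intro convergent_diff conv hull_zer y y')
    then obtain l where "(\<lambda>k. (norm (\<xi> k - y'))\<^sup>2 - (norm (\<xi> k - y))\<^sup>2) \<longlonglongrightarrow> l"
      by (auto simp: convergent_def)
    then have "(\<lambda>k. ((norm (\<xi> k - y'))\<^sup>2 - (norm (\<xi> k - y))\<^sup>2 - y' \<bullet> y' + y \<bullet> y) / 2)
        \<longlonglongrightarrow> (l - y' \<bullet> y' + y \<bullet> y) / 2"
      by (intro tendsto_intros) auto
    moreover have "((norm (\<xi> k - y'))\<^sup>2 - (norm (\<xi> k - y))\<^sup>2 - y' \<bullet> y' + y \<bullet> y) / 2 = \<xi> k \<bullet> (y - y')" for k
      unfolding power2_norm_eq_inner by (simp add: inner_simps inner_commute)
    ultimately have lim: "(\<lambda>k. \<xi> k \<bullet> (y - y')) \<longlonglongrightarrow> (l - y' \<bullet> y' + y \<bullet> y) / 2"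
      by simp
    have "y \<bullet> (y - y') = y' \<bullet> (y - y')"
      using tail_hull_point_inner_limit[OF y lim] tail_hull_point_inner_limit[OF y' lim] by simp
    then have "(y - y') \<bullet> (y - y') = 0" by (simp only: inner_diff_left)
    then show ?thesis by simp
  qed
  obtain y where y: "tail_hull_point \<xi> y"
    by (rule bounded_has_tail_hull_point[OF bounded])
  have "weakly_converges \<xi> y"
    by (rule weakly_converges_if_unique_tail_hull_point[OF bounded unique[OF y]])
  with hull_zer[OF y] show ?thesis by (rule that)
qed

section \<open>Stability under summable errors\<close>

lemma tendsto_zero_if_tail_bounds:
  fixes h :: "nat \<Rightarrow> 'a::real_normed_vector"
  assumes le: "\<And>i k. norm (h (i + k)) \<le> R i + g i k"
    and "R \<longlonglongrightarrow> (0::real)" and g: "\<And>i. g i \<longlonglongrightarrow> (0::real)"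
  shows "h \<longlonglongrightarrow> 0"
proof (rule tendsto_norm_zero_cancel, rule order_tendstoI)
  fix a :: real assume "0 < a"
  then have "\<forall>\<^sub>F i in sequentially. R i < a / 2"
    using assms(2) by (intro order_tendstoD(2)[where y = 0]) auto
  then obtain i where i: "R i < a / 2" by (auto simp: eventually_sequentially)
  have "\<forall>\<^sub>F k in sequentially. g i k < a / 2"
    using \<open>0 < a\<close> g by (intro order_tendstoD(2)[where y = 0]) auto
  then have "\<forall>\<^sub>F k in sequentially. norm (h (k + i)) < a"
  proof (rule eventually_mono)
    fix k assume "g i k < a / 2"
    with i le[of i k] show "norm (h (k + i)) < a" by (simp add: add.commute)
  qed
  then show "\<forall>\<^sub>F k in sequentially. norm (h k) < a"
    using eventually_sequentially_seg[of "\<lambda>k. norm (h k) < a" i] by simp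
qed (auto intro!: always_eventually intro: less_le_trans)

text \<open>Restarting the exact iteration one step later changes its start by the error made in that step,
  and nonexpansive maps never enlarge this discrepancy, nor do weak limits. So all the relevant
  distances are controlled by tails of the series of errors.\<close>

lemma perturbed_nonexpansive_iteration:
  fixes T :: "nat \<Rightarrow> 'a::{real_inner, complete_space} \<Rightarrow> 'a"
  assumes nonexp: "\<And>k u v. norm (T k u - T k v) \<le> norm (u - v)"
    and err: "summable (\<lambda>k. norm (x (Suc k) - T k (x k)))"
    and start: "\<And>i. \<xi> 0 i = x i" and step: "\<And>i k. \<xi> (Suc k) i = T (k + i) (\<xi> k i)"
    and weak: "\<And>i. weakly_converges (\<lambda>k. \<xi> k i) (\<xi>lim i)"
  obtains \<xi>bar where "\<xi>lim \<longlonglongrightarrow> \<xi>bar" "weakly_converges x \<xi>bar"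
    "(\<And>i. (\<lambda>k. \<xi> k i) \<longlonglongrightarrow> \<xi>lim i) \<Longrightarrow> x \<longlonglongrightarrow> \<xi>bar"
proof -
  define d where "d k = norm (x (Suc k) - T k (x k))" for k
  define R where "R i = (\<Sum>j. d (j + i))" for i
  have d: "summable d" "\<And>k. 0 \<le> d k" using err by (simp_all add: d_def[abs_def])
  have R0: "R \<longlonglongrightarrow> 0" unfolding R_def using d(1) by (rule suminf_exist_split2)
  have sum_le: "(\<Sum>j<n. d (j + i)) \<le> R i" for i n
    unfolding R_def using d by (intro sum_le_suminf) (auto simp: summable_iff_shift)
  have restart: "norm (\<xi> k (Suc i) - \<xi> (Suc k) i) \<le> d i" for i k
  proof (induction k)
    case 0
    show ?case by (simp add: step start d_def)
  next
    case (Suc k)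
    then show ?case
      using nonexp[of "Suc (k + i)" "\<xi> k (Suc i)" "\<xi> (Suc k) i"] by (simp add: step)
  qed
  have lim_step: "norm (\<xi>lim (Suc i) - \<xi>lim i) \<le> d i" for i
  proof (rule weak_limit_norm_le)
    have "weakly_converges (\<lambda>k. \<xi> (Suc k) i) (\<xi>lim i)"
      using weak[of i] unfolding weakly_converges_def by (auto intro: LIMSEQ_Suc)
    with weak[of "Suc i"] show "weakly_converges (\<lambda>k. \<xi> k (Suc i) - \<xi> (Suc k) i) (\<xi>lim (Suc i) - \<xi>lim i)"
      by (rule weakly_converges_diff)
  qed (rule restart)
  have "norm (\<xi>lim (i + n) - \<xi>lim i) \<le> (\<Sum>j<n. d (j + i))" for i n
  proof (induction n)
    case (Suc n)
    then show ?case
      using norm_triangle_ineq[of "\<xi>lim (Suc (i + n)) - \<xi>lim (i + n)" "\<xi>lim (i + n) - \<xi>lim i"]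
        lim_step[of "i + n"] by (simp add: add.commute)
  qed simp
  then have "norm (\<xi>lim (i + n) - \<xi>lim i) \<le> R i" for i n
    using sum_le order_trans by blast
  then have lim_le: "norm (\<xi>lim m - \<xi>lim n) \<le> R n" if "n \<le> m" for m n
    using that by (metis le_add_diff_inverse)
  then have "Cauchy \<xi>lim" using R0 by (rule Cauchy_if_norm_diff_le)
  then obtain \<xi>bar where bar: "\<xi>lim \<longlonglongrightarrow> \<xi>bar"
    using Cauchy_convergent convergent_def by blast
  have bar_le: "norm (\<xi>lim i - \<xi>bar) \<le> R i" for i
  proof (rule LIMSEQ_le_const2)
    show "(\<lambda>m. norm (\<xi>lim i - \<xi>lim m)) \<longlonglongrightarrow> norm (\<xi>lim i - \<xi>bar)"
      by (intro tendsto_intros bar)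
    show "\<exists>N. \<forall>m\<ge>N. norm (\<xi>lim i - \<xi>lim m) \<le> R i"
      using lim_le by (metis norm_minus_commute)
  qed
  have "norm (x (i + k) - \<xi> k i) \<le> (\<Sum>j<k. d (j + i))" for i k
  proof (induction k)
    case 0
    show ?case by (simp add: start)
  next
    case (Suc k)
    have "x (i + Suc k) - \<xi> (Suc k) i
        = (x (Suc (k + i)) - T (k + i) (x (k + i))) + (T (k + i) (x (i + k)) - T (k + i) (\<xi> k i))"
      by (simp add: step add.commute)
    then have "norm (x (i + Suc k) - \<xi> (Suc k) i) \<le> d (k + i) + norm (x (i + k) - \<xi> k i)"
      using norm_triangle_ineq nonexp[of "k + i" "x (i + k)" "\<xi> k i"]
      by (smt (verit) d_def)
    then show ?case using Suc by simp
  qed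
  then have track: "norm (x (i + k) - \<xi> k i) \<le> R i" for i k
    using sum_le order_trans by blast
  \<comment> \<open>The two moves \<open>x (i + k)\<close> to \<open>\<xi> k i\<close> and \<open>\<xi>lim i\<close> to \<open>\<xi>bar\<close> together cost at most \<open>2 * R i\<close>,
    uniformly in \<open>k\<close>; what is left is the convergence of a single exact orbit.\<close>
  have split: "x (i + k) - \<xi>bar = (x (i + k) - \<xi> k i) + (\<xi>lim i - \<xi>bar) + (\<xi> k i - \<xi>lim i)" for i k
    by simp
  have small: "norm ((x (i + k) - \<xi> k i) + (\<xi>lim i - \<xi>bar)) \<le> 2 * R i" for i k
    using norm_triangle_ineq[of "x (i + k) - \<xi> k i" "\<xi>lim i - \<xi>bar"] track[of i k] bar_le[of i]
    by simp
  have "weakly_converges x \<xi>bar"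
    unfolding weakly_converges_def
  proof
    fix u
    have "(\<lambda>n. (x n - \<xi>bar) \<bullet> u) \<longlonglongrightarrow> 0"
    proof (rule tendsto_zero_if_tail_bounds)
      show "(\<lambda>i. 2 * R i * norm u) \<longlonglongrightarrow> 0"
        using tendsto_mult_left_zero[OF tendsto_mult_right_zero[OF R0]] by blast
      have "(\<lambda>k. \<xi> k i \<bullet> u - \<xi>lim i \<bullet> u) \<longlonglongrightarrow> 0" for i
        using weak[of i] by (simp add: weakly_converges_def LIM_zero_iff)
      then show "(\<lambda>k. \<bar>(\<xi> k i - \<xi>lim i) \<bullet> u\<bar>) \<longlonglongrightarrow> 0" for i
        by (simp add: inner_diff_left tendsto_rabs_zero)
      show "norm ((x (i + k) - \<xi>bar) \<bullet> u) \<le> 2 * R i * norm u + \<bar>(\<xi> k i - \<xi>lim i) \<bullet> u\<bar>" for i k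
      proof -
        have "\<bar>((x (i + k) - \<xi> k i) + (\<xi>lim i - \<xi>bar)) \<bullet> u\<bar> \<le> 2 * R i * norm u"
          by (rule order_trans[OF Cauchy_Schwarz_ineq2 mult_right_mono[OF small norm_ge_zero]])
        then show ?thesis unfolding split[of i k] inner_add_left[of _ "\<xi> k i - \<xi>lim i"] by simp
      qed
    qed
    then show "(\<lambda>k. x k \<bullet> u) \<longlonglongrightarrow> \<xi>bar \<bullet> u" by (simp add: inner_diff_left LIM_zero_iff)
  qed
  moreover have "x \<longlonglongrightarrow> \<xi>bar" if strong: "\<And>i. (\<lambda>k. \<xi> k i) \<longlonglongrightarrow> \<xi>lim i"
  proof -
    have "(\<lambda>n. x n - \<xi>bar) \<longlonglongrightarrow> 0"
    proof (rule tendsto_zero_if_tail_bounds)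
      show "(\<lambda>i. 2 * R i) \<longlonglongrightarrow> 0" by (rule tendsto_mult_right_zero[OF R0])
      show "(\<lambda>k. norm (\<xi> k i - \<xi>lim i)) \<longlonglongrightarrow> 0" for i
        using strong[of i] by (intro tendsto_norm_zero) (simp add: LIM_zero_iff)
      show "norm (x (i + k) - \<xi>bar) \<le> 2 * R i + norm (\<xi> k i - \<xi>lim i)" for i k
        unfolding split[of i k] by (rule order_trans[OF norm_triangle_ineq add_right_mono[OF small]])
    qed
    then show ?thesis by (simp add: LIM_zero_iff)
  qed
  ultimately show ?thesis using bar that by blast
qed

text \<open>Replacing the varying parameters \<open>cs k\<close> by \<open>c\<close> turns the given iteration into a perturbed one.
  Its errors are summable because the iterates stay bounded: every resolvent fixes every zero.\<close>

lemma proximal_iteration_errors_summable: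
  fixes A :: "'a::{real_inner, complete_space} set_op"
  assumes max: "maximally_monotone_op A" and "zer A \<noteq> {}"
    and lam: "\<And>k. lam k \<in> {0<..2::real}" and cs: "\<And>k. cs k > 0" and \<eta>: "\<And>k. \<eta> k \<ge> 0"
    and step: "\<And>k. x (Suc k) =
        (1 - lam k) *\<^sub>R x k + lam k *\<^sub>R resolvent (scale_op (cs k) A) (x k) + \<eta> k *\<^sub>R e k"
    and sum_e: "summable (\<lambda>k. \<eta> k * norm (e k))"
    and "c > 0" and sum_c: "summable (\<lambda>k. \<bar>cs k / c - 1\<bar>)"
  shows "summable (\<lambda>k. norm (x (Suc k) -
      ((1 - lam k) *\<^sub>R x k + lam k *\<^sub>R resolvent (scale_op c A) (x k))))"
proof -
  obtain z where z: "z \<in> zer A" using \<open>zer A \<noteq> {}\<close> by blast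
  define M where "M = norm (x 0 - z) + (\<Sum>k. \<eta> k * norm (e k))"
  have fix_z: "resolvent (scale_op \<gamma> A) z = z" if "\<gamma> > 0" for \<gamma>
    using z by (simp add: resolvent_fixed_iff_zer[OF max that])
  have dist_step: "norm (x (Suc k) - z) \<le> norm (x k - z) + \<eta> k * norm (e k)" for k
  proof -
    let ?J = "resolvent (scale_op (cs k) A)"
    have zz: "(1 - lam k) *\<^sub>R z + lam k *\<^sub>R ?J z = z"
      by (simp add: fix_z[OF cs] algebra_simps)
    have "x (Suc k) - z = (((1 - lam k) *\<^sub>R x k + lam k *\<^sub>R ?J (x k)) - z) + \<eta> k *\<^sub>R e k"
      by (simp add: step)
    also have "norm \<dots> \<le> norm (((1 - lam k) *\<^sub>R x k + lam k *\<^sub>R ?J (x k)) - z) + norm (\<eta> k *\<^sub>R e k)"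
      by (rule norm_triangle_ineq)
    also have "norm (((1 - lam k) *\<^sub>R x k + lam k *\<^sub>R ?J (x k)) - z) \<le> norm (x k - z)"
      using relaxation_nonexpansive[OF firmly_nonexpansive_resolvent[OF max cs[of k]] lam[of k], of "x k" z]
      unfolding zz .
    finally show ?thesis using \<eta>[of k] by simp
  qed
  have "norm (x n - z) \<le> norm (x 0 - z) + (\<Sum>k<n. \<eta> k * norm (e k))" for n
  proof (induction n)
    case (Suc n)
    then show ?case using dist_step[of n] by simp
  qed simp
  moreover have "(\<Sum>k<n. \<eta> k * norm (e k)) \<le> (\<Sum>k. \<eta> k * norm (e k))" for n
    using \<eta> by (intro sum_le_suminf sum_e) auto
  ultimately have bounded: "norm (x n - z) \<le> M" for n
    unfolding M_def by (meson add_left_mono order_trans)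
  have residual: "norm (u - resolvent (scale_op c A) u) \<le> norm (u - z)" for u
  proof -
    \<comment> \<open>Relaxation with parameter \<open>1\<close> bounds the residual as well as the image.\<close>
    have "(norm (resolvent (scale_op c A) u - z))\<^sup>2
        \<le> (norm (u - z))\<^sup>2 - (norm (u - resolvent (scale_op c A) u))\<^sup>2"
      using relaxation_contracts[OF firmly_nonexpansive_resolvent[OF max \<open>c > 0\<close>] zero_le_one, of u z]
      by (simp add: fix_z[OF \<open>c > 0\<close>])
    then have "(norm (u - resolvent (scale_op c A) u))\<^sup>2 \<le> (norm (u - z))\<^sup>2"
      using zero_le_power2[of "norm (resolvent (scale_op c A) u - z)"] by linarith
    then show ?thesis by (rule power2_le_imp_le) (rule norm_ge_zero)
  qed
  show ?thesis
  proof (rule summable_comparison_test_ev)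
    show "summable (\<lambda>k. 2 * M * \<bar>cs k / c - 1\<bar> + \<eta> k * norm (e k))"
      by (intro summable_add summable_mult sum_c sum_e)
    have "norm (x (Suc k) - ((1 - lam k) *\<^sub>R x k + lam k *\<^sub>R resolvent (scale_op c A) (x k)))
        \<le> 2 * M * \<bar>cs k / c - 1\<bar> + \<eta> k * norm (e k)" for k
    proof -
      let ?q = "resolvent (scale_op (cs k) A) (x k)" and ?p = "resolvent (scale_op c A) (x k)"
      have "x (Suc k) - ((1 - lam k) *\<^sub>R x k + lam k *\<^sub>R ?p) = lam k *\<^sub>R (?q - ?p) + \<eta> k *\<^sub>R e k"
        by (simp add: step algebra_simps)
      then have "norm (x (Suc k) - ((1 - lam k) *\<^sub>R x k + lam k *\<^sub>R ?p))
          = norm (lam k *\<^sub>R (?q - ?p) + \<eta> k *\<^sub>R e k)" by (rule arg_cong)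
      moreover have "norm (lam k *\<^sub>R (?q - ?p) + \<eta> k *\<^sub>R e k)
          \<le> lam k * norm (?q - ?p) + \<eta> k * norm (e k)"
        using norm_triangle_ineq[of "lam k *\<^sub>R (?q - ?p)" "\<eta> k *\<^sub>R e k"] lam[of k] \<eta>[of k] by simp
      moreover have "norm (?q - ?p) \<le> \<bar>cs k / c - 1\<bar> * M"
        by (rule order_trans[OF resolvent_parameter_change[OF max \<open>c > 0\<close> cs]
              mult_left_mono[OF order_trans[OF residual bounded]]]) simp
      then have "lam k * norm (?q - ?p) \<le> 2 * (\<bar>cs k / c - 1\<bar> * M)"
        using lam[of k] by (intro mult_mono) auto
      moreover have "2 * (\<bar>cs k / c - 1\<bar> * M) = 2 * M * \<bar>cs k / c - 1\<bar>" by simp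
      ultimately show ?thesis by linarith
    qed
    then show "\<forall>\<^sub>F k in sequentially. norm (norm (x (Suc k) -
        ((1 - lam k) *\<^sub>R x k + lam k *\<^sub>R resolvent (scale_op c A) (x k))))
        \<le> 2 * M * \<bar>cs k / c - 1\<bar> + \<eta> k * norm (e k)" by simp
  qed
qed

section \<open>The inexact relaxed proximal point algorithm\<close>

theorem theorem5p7:
  fixes A :: "'a::{real_inner, complete_space} set_op"
    and x e :: "nat \<Rightarrow> 'a"
    and lam cs \<eta> :: "nat \<Rightarrow> real"
    and c :: real
  assumes "maximally_monotone_op A"
    and "zer A \<noteq> {}"
    and "\<And>k. lam k \<in> {0<..2}"
    and "\<And>k. cs k \<in> {0<..}"
    and "\<And>k. \<eta> k \<in> {0..}"
    and "\<And>k. x (Suc k) =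
           (1 - lam k) *\<^sub>R x k + lam k *\<^sub>R resolvent (scale_op (cs k) A) (x k) + \<eta> k *\<^sub>R e k"
    and "summable (\<lambda>k. \<eta> k * norm (e k))"
    and "c \<in> {0<..}"
    and "summable (\<lambda>k. \<bar>cs k / c - 1\<bar>)"
  shows "(\<forall>(\<xi> :: nat \<Rightarrow> nat \<Rightarrow> 'a) (\<xi>lim :: nat \<Rightarrow> 'a).
            (\<forall>i. \<xi> 0 i = x i) \<longrightarrow>
            (\<forall>i k. \<xi> (Suc k) i =
               (1 - lam (k + i)) *\<^sub>R \<xi> k i
               + lam (k + i) *\<^sub>R resolvent (scale_op c A) (\<xi> k i)) \<longrightarrow>
            (\<forall>i. weakly_converges (\<lambda>k. \<xi> k i) (\<xi>lim i)) \<longrightarrow>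
            (\<exists>\<xi>bar.
               \<xi>lim \<longlonglongrightarrow> \<xi>bar
               \<and> weakly_converges x \<xi>bar
               \<and> ((\<forall>i. (\<lambda>k. \<xi> k i) \<longlonglongrightarrow> \<xi>lim i) \<longrightarrow> x \<longlonglongrightarrow> \<xi>bar)))
         \<and> (filterlim (\<lambda>n. \<Sum>k<n. lam k * (2 - lam k)) at_top sequentially \<longrightarrow>
            (\<exists>z \<in> zer A. weakly_converges x z))"
proof -
  note max = assms(1) and lam = assms(3)
  have c: "c > 0" using assms(8) by simp
  define T where "T k u = (1 - lam k) *\<^sub>R u + lam k *\<^sub>R resolvent (scale_op c A) u" for k u
  have nonexp: "norm (T k u - T k v) \<le> norm (u - v)" for k u v
    unfolding T_def by (rule relaxation_nonexpansive[OF firmly_nonexpansive_resolvent[OF max c] lam])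
  have err: "summable (\<lambda>k. norm (x (Suc k) - T k (x k)))"
    unfolding T_def
    by (rule proximal_iteration_errors_summable[OF max assms(2) lam _ _ assms(6,7) c assms(9)])
      (use assms(4,5) in simp_all)
  have part_i: "\<exists>\<xi>bar. \<xi>lim \<longlonglongrightarrow> \<xi>bar \<and> weakly_converges x \<xi>bar
      \<and> ((\<forall>i. (\<lambda>k. \<xi> k i) \<longlonglongrightarrow> \<xi>lim i) \<longrightarrow> x \<longlonglongrightarrow> \<xi>bar)"
    if "\<forall>i. \<xi> 0 i = x i" "\<forall>i k. \<xi> (Suc k) i = T (k + i) (\<xi> k i)"
      "\<forall>i. weakly_converges (\<lambda>k. \<xi> k i) (\<xi>lim i)" for \<xi> \<xi>lim
  proof (rule perturbed_nonexpansive_iteration[OF nonexp err])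
    show "\<xi> 0 i = x i" for i using that(1) ..
    show "\<xi> (Suc k) i = T (k + i) (\<xi> k i)" for i k using that(2) by blast
    show "weakly_converges (\<lambda>k. \<xi> k i) (\<xi>lim i)" for i using that(3) ..
  qed blast
  moreover have "\<exists>z \<in> zer A. weakly_converges x z"
    if div: "filterlim (\<lambda>n. \<Sum>k<n. lam k * (2 - lam k)) at_top sequentially"
  proof -
    define \<xi> where "\<xi> k i = rec_nat (x i) (\<lambda>k. T (k + i)) k" for k i
    have start: "\<xi> 0 i = x i" and step: "\<xi> (Suc k) i = T (k + i) (\<xi> k i)" for i k
      by (simp_all add: \<xi>_def)
    have "\<exists>y. y \<in> zer A \<and> weakly_converges (\<lambda>k. \<xi> k i) y" for i
    proof (rule exact_relaxed_iteration_weakly_converges[OF max c assms(2) lam])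
      show "\<xi> (Suc k) i = (1 - lam (k + i)) *\<^sub>R \<xi> k i + lam (k + i) *\<^sub>R resolvent (scale_op c A) (\<xi> k i)"
        for k by (simp only: step T_def)
      show "filterlim (\<lambda>n. \<Sum>k<n. lam (k + i) * (2 - lam (k + i))) at_top sequentially"
        using div by (rule filterlim_sum_shift)
    qed blast
    then obtain \<xi>lim where lim: "\<And>i. \<xi>lim i \<in> zer A" "\<And>i. weakly_converges (\<lambda>k. \<xi> k i) (\<xi>lim i)"
      by metis
    obtain z where z: "\<xi>lim \<longlonglongrightarrow> z" "weakly_converges x z"
      using part_i[of \<xi> \<xi>lim] start step lim(2) by blast
    \<comment> \<open>The zero set is closed: each pair of the graph imposes a closed condition on a zero.\<close>
    have "0 \<in> A z"
    proof (rule maximally_monotoneI_related[OF max])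
      fix a b assume "b \<in> A a"
      show "0 \<le> (a - z) \<bullet> (b - 0)"
      proof (rule LIMSEQ_le_const)
        show "(\<lambda>i. (a - \<xi>lim i) \<bullet> (b - 0)) \<longlonglongrightarrow> (a - z) \<bullet> (b - 0)"
          by (intro tendsto_intros z)
        show "\<exists>N. \<forall>i\<ge>N. 0 \<le> (a - \<xi>lim i) \<bullet> (b - 0)"
          using maximally_monotoneD[OF max \<open>b \<in> A a\<close>] lim(1) unfolding zer_def by blast
      qed
    qed
    with z(2) show ?thesis unfolding zer_def by blast
  qed
  ultimately show ?thesis unfolding T_def by (intro conjI allI impI)
qed

end
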